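(* Let $n\ge 1$ and let $f$ be a (single-valued or multi-valued) mapping acting in $\mathbb{R}^n$ with domain $D(f)\subseteq\mathbb{R}^n$. Let $G\subset\mathbb{R}^n$ with $G\subseteq D(f)$, and suppose: 1) $f(G)$ is a convex subset of $\mathbb{R}^n$; 2) there exists a linear subspace $X$ of $\mathbb{R}^n$ of dimension $k$, $0<k\le n$, such that for every $x_0\in S_1^{\mathbb{R}^n}(0)\cap X$ there exists $x_1\in G\cap X$ with $$\{\langle y,x_0\rangle : y\in f(x_1)\cap X\}\cap(0,\infty)\neq\varnothing .$$ Then $0\in f(G)$, i.e. there exists $\widehat{x}\in G$ with $0\in f(\widehat{x})$ (if $f$ is single-valued, $f(\widehat{x})=0$). The same holds if $(0,\infty)$ is replaced by $(-\infty,0)$ in condition 2).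
   Context: $S_1^{\mathbb{R}^n}(0)$ is the unit sphere of $\mathbb{R}^n$ and $\langle\cdot,\cdot\rangle$ the Euclidean inner product. No continuity of $f$ is assumed. A multi-valued mapping assigns to each $x\in D(f)$ a nonempty subset $f(x)$; $f(G)=\bigcup_{x\in G}f(x)$. A single-valued $f$ is treated as the multi-valued map $x\mapsto\{f(x)\}$. *)

theory Defs
  imports "HOL-Analysis.Analysis"
begin

(* A multi-valued mapping in R^n with domain D is encoded as a function f :: real^'n => (real^'n) set
   together with the set D; values outside D are irrelevant. *)
definition multivalued_on :: "'a set \<Rightarrow> ('a \<Rightarrow> 'b set) \<Rightarrow> bool" where
  "multivalued_on D f \<longleftrightarrow> (\<forall>x\<in>D. f x \<noteq> {})"

definition mv_image :: "('a \<Rightarrow> 'b set) \<Rightarrow> 'a set \<Rightarrow> 'b set" where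
  "mv_image f G = (\<Union>x\<in>G. f x)"

end

theory Submission imports Defs begin

text \<open>
  If \<open>0 \<notin> f(G)\<close>, a hyperplane separates \<open>0\<close> from the nonempty convex set \<open>f(G) \<inter> X\<close>; in finite
  dimension this needs no closedness. Its normal can be taken in \<open>X\<close>, and normalised with the sign
  opposite to \<open>J\<close> it contradicts condition 2).
\<close>


theorem theorem6:
  fixes f :: "real ^ 'n \<Rightarrow> (real ^ 'n) set"
    and D G :: "(real ^ 'n) set"
    and J :: "real set"
  assumes "multivalued_on D f"
    and "G \<subseteq> D"
    and "convex (mv_image f G)"
    and "J = {0<..} \<or> J = {..<0}"
    and "\<exists>(X :: (real ^ 'n) set) (k :: nat).
           subspace X \<and> dim X = k \<and> 0 < k \<and> k \<le> CARD('n) \<and>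
           (\<forall>x0 \<in> sphere 0 1 \<inter> X. \<exists>x1 \<in> G \<inter> X.
              {y \<bullet> x0 | y. y \<in> f x1 \<inter> X} \<inter> J \<noteq> {})"
  shows "0 \<in> mv_image f G
       \<and> (\<exists>x \<in> G. 0 \<in> f x)
       \<and> (\<forall>g :: real ^ 'n \<Rightarrow> real ^ 'n. (\<forall>x\<in>D. f x = {g x}) \<longrightarrow> (\<exists>x \<in> G. g x = 0))"
proof -
  obtain X :: "(real ^ 'n) set" where X: "subspace X" "0 < dim X"
    and ex: "\<And>x0. x0 \<in> sphere 0 1 \<inter> X \<Longrightarrow>
               \<exists>x1 \<in> G \<inter> X. {y \<bullet> x0 | y. y \<in> f x1 \<inter> X} \<inter> J \<noteq> {}"
    using assms(5) by blast
  define C where "C = mv_image f G \<inter> X"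
  \<comment> \<open>Both choices of \<open>J\<close> are invariant under positive scaling, so the
    condition on unit vectors passes to every nonzero \<open>a\<close> in \<open>X\<close>. The sign
    \<open>c\<close> lets one fact serve both half-lines.\<close>
  have hit: "\<exists>y\<in>C. c * (y \<bullet> a) \<in> J" if "a \<in> X" "a \<noteq> 0" "\<bar>c\<bar> = 1" for a c
  proof -
    have "(c / norm a) *\<^sub>R a \<in> sphere 0 1 \<inter> X"
      using that X(1) by (simp add: subspace_scale)
    from ex[OF this] obtain x1 y where "x1 \<in> G" "y \<in> f x1" "y \<in> X"
      and J: "y \<bullet> ((c / norm a) *\<^sub>R a) \<in> J"
      by blast
    then have "y \<in> C"
      by (auto simp: C_def mv_image_def)
    moreover have "c * (y \<bullet> a) \<in> J"
      using assms(4) J that(2) by (auto simp: field_simps)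
    ultimately show ?thesis by blast
  qed
  have "0 \<in> C"
  proof (rule ccontr)
    assume "0 \<notin> C"
    \<comment> \<open>Positive dimension enters here: condition 2) yields a point of
      \<open>C\<close> only if \<open>X\<close> has a unit vector.\<close>
    obtain u where "u \<in> X" "u \<noteq> 0"
      using X(2) by (metis dim_eq_0 less_irrefl singletonI subsetI)
    then have "C \<noteq> {}"
      using hit[of u 1] by auto
    moreover have "convex C"
      unfolding C_def using assms(3) subspace_imp_convex[OF X(1)] by (rule convex_Int)
    \<comment> \<open>This form of separation keeps the normal in the affine hull of
      \<open>0\<close> and \<open>C\<close>, hence in \<open>X\<close>; for a normal outside
      \<open>X\<close>, \<open>hit\<close> would say nothing.\<close>
    ultimately obtain a b where a: "0 + a \<in> affine hull (insert 0 C)" "a \<noteq> 0"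
      and b: "a \<bullet> 0 \<le> b" "\<And>x. x \<in> C \<Longrightarrow> b \<le> a \<bullet> x"
      using separating_hyperplane_set_point_inaff[OF _ _ \<open>0 \<notin> C\<close>] by blast
    have "affine hull (insert 0 C) \<subseteq> X"
      using X(1) by (intro hull_minimal subspace_imp_affine) (auto simp: C_def subspace_0)
    with a(1) have "a \<in> X" by auto
    \<comment> \<open>The separation need not be strict, but this weak inequality suffices because
      \<open>J\<close> omits 0.\<close>
    have nonneg: "0 \<le> y \<bullet> a" if "y \<in> C" for y
      using b(1) b(2)[OF that] by (simp add: inner_commute)
    from assms(4) show False
    proof
      assume "J = {0<..}"
      then show False
        using hit[OF \<open>a \<in> X\<close> a(2), of "-1"] nonneg by force
    next
      assume "J = {..<0}"
      then show False
        using hit[OF \<open>a \<in> X\<close> a(2), of 1] nonneg by force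
    qed
  qed
  then have "0 \<in> mv_image f G"
    by (simp add: C_def)
  with assms(2) show ?thesis
    unfolding mv_image_def by fastforce
qed

end
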